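(* Let $N \ge 2$ be an integer and let $X_1, \ldots, X_N$ be independent and identically distributed real random variables with mean $\mu$ and finite variance $\sigma^2$. Let $c_1, \ldots, c_N$ be real numbers satisfying $$\sum_{n=1}^N c_n = 1, \qquad \sum_{n=1}^N c_n^2 = \frac{2}{N}.$$ Put $\hat{X} = \sum_{n=1}^N c_n X_n$ and $$\hat{s}^2 = \frac{1}{N} \sum_{n=1}^N (X_n - \hat{X})^2.$$ Then $\hat{s}^2$ is an unbiased estimator of $\sigma^2$, that is, $\mathbb{E}[\hat{s}^2] = \sigma^2$, and $\hat{X}$ is an unbiased estimator of $\mu$, that is, $\mathbb{E}[\hat{X}] = \mu$.
   Context: All random variables are real-valued and defined on a common probability space; $\mathbb{E}$ denotes expectation. *)

theory Defs
  imports "HOL-Probability.Probability"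
begin

definition iid :: "'a measure \<Rightarrow> ('i \<Rightarrow> 'a \<Rightarrow> real) \<Rightarrow> 'i set \<Rightarrow> bool" where
  "iid M X I \<longleftrightarrow>
     prob_space.indep_vars M (\<lambda>_. borel) X I \<and>
     (\<forall>i\<in>I. \<forall>j\<in>I. distr M borel (X i) = distr M borel (X j))"

definition weighted_mean :: "nat \<Rightarrow> (nat \<Rightarrow> real) \<Rightarrow> (nat \<Rightarrow> 'a \<Rightarrow> real) \<Rightarrow> 'a \<Rightarrow> real" where
  "weighted_mean N c X \<omega> = (\<Sum>n=1..N. c n * X n \<omega>)"

definition weighted_sample_var :: "nat \<Rightarrow> (nat \<Rightarrow> real) \<Rightarrow> (nat \<Rightarrow> 'a \<Rightarrow> real) \<Rightarrow> 'a \<Rightarrow> real" where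
  "weighted_sample_var N c X \<omega> = 1 / real N * (\<Sum>n=1..N. (X n \<omega> - weighted_mean N c X \<omega>)\<^sup>2)"

text \<open>The Bochner integral of a non-integrable function is 0, so the existence of the
  expectation is required explicitly.\<close>

definition unbiased_estimator :: "'a measure \<Rightarrow> ('a \<Rightarrow> real) \<Rightarrow> real \<Rightarrow> bool" where
  "unbiased_estimator M T \<theta> \<longleftrightarrow> integrable M T \<and> prob_space.expectation M T = \<theta>"

end

theory Submission
  imports Defs
begin

text \<open>In terms of the centred variables \<open>Y n = X n - \<mu>\<close> and \<open>L = (\<Sum>n. c n * Y n)\<close> one has
  \<open>X n - weighted_mean N c X = Y n - L\<close>, because the weights sum to \<open>1\<close>. Expanding the squares gives
  \<open>(\<Sum>n. (Y n - L)\<^sup>2) = (\<Sum>n. (Y n)\<^sup>2) - 2 * L * (\<Sum>n. Y n) + N * L\<^sup>2\<close>. As the \<open>Y n\<close> are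
  orthogonal with variance \<open>\<sigma>\<^sup>2\<close>, the three expectations are \<open>N * \<sigma>\<^sup>2\<close>, \<open>- 2 * \<sigma>\<^sup>2\<close> and
  \<open>N * \<sigma>\<^sup>2 * (\<Sum>n. (c n)\<^sup>2) = 2 * \<sigma>\<^sup>2\<close>; the last two cancel.\<close>

text \<open>Expanding the product gives a double sum in which orthogonality leaves only the
  diagonal. Two coefficient families are allowed so that both \<open>L * (\<Sum>n. Y n)\<close> and
  \<open>L * L\<close> are instances. \<open>has_bochner_integral\<close> carries integrability
  along with the value, as \<open>unbiased_estimator\<close> demands both.\<close>

lemma has_bochner_integral_orthogonal_linear_combinations:
  fixes Y :: "'i \<Rightarrow> 'a \<Rightarrow> real"
  assumes "finite I"
    and orth: "\<And>i j. i \<in> I \<Longrightarrow> j \<in> I \<Longrightarrow>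
      has_bochner_integral M (\<lambda>\<omega>. Y i \<omega> * Y j \<omega>) (if i = j then v else 0)"
  shows "has_bochner_integral M (\<lambda>\<omega>. (\<Sum>i\<in>I. a i * Y i \<omega>) * (\<Sum>j\<in>I. b j * Y j \<omega>))
    ((\<Sum>i\<in>I. a i * b i) * v)"
proof -
  have "has_bochner_integral M (\<lambda>\<omega>. \<Sum>i\<in>I. \<Sum>j\<in>I. a i * b j * (Y i \<omega> * Y j \<omega>))
    (\<Sum>i\<in>I. \<Sum>j\<in>I. a i * b j * (if i = j then v else 0))"
    by (intro has_bochner_integral_sum has_bochner_integral_mult_right orth)
  moreover have "(\<Sum>i\<in>I. \<Sum>j\<in>I. a i * b j * (if i = j then v else 0)) = (\<Sum>i\<in>I. a i * b i) * v"
    using \<open>finite I\<close> by (simp add: sum_distrib_right if_distrib cong: if_cong)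
  moreover have "(\<Sum>i\<in>I. a i * Y i \<omega>) * (\<Sum>j\<in>I. b j * Y j \<omega>)
      = (\<Sum>i\<in>I. \<Sum>j\<in>I. a i * b j * (Y i \<omega> * Y j \<omega>))" for \<omega>
    by (simp add: sum_product mult_ac)
  ultimately show ?thesis by simp
qed

text \<open>On the diagonal this is the variance. Off it, independence makes the product integrable
  and factors its expectation into two means, both 0 after centring.\<close>

lemma (in prob_space) has_bochner_integral_indep_centred:
  fixes X :: "'i \<Rightarrow> 'a \<Rightarrow> real"
  assumes indep: "indep_vars (\<lambda>_. borel) X I" and "i \<in> I" "j \<in> I"
    and int: "\<And>k. k \<in> I \<Longrightarrow> integrable M (X k)"
    and mean: "\<And>k. k \<in> I \<Longrightarrow> expectation (X k) = \<mu>"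
    and sq: "\<And>k. k \<in> I \<Longrightarrow> integrable M (\<lambda>\<omega>. (X k \<omega> - \<mu>)\<^sup>2)"
    and var: "\<And>k. k \<in> I \<Longrightarrow> variance (X k) = v"
  shows "has_bochner_integral M (\<lambda>\<omega>. (X i \<omega> - \<mu>) * (X j \<omega> - \<mu>)) (if i = j then v else 0)"
proof (cases "i = j")
  case True
  then show ?thesis
    using sq[of j] var[of j] mean[of j] \<open>j \<in> I\<close>
    by (simp add: has_bochner_integral_iff power2_eq_square)
next
  case False
  have "indep_vars (\<lambda>_. borel) (\<lambda>k \<omega>. X k \<omega> - \<mu>) I"
    by (rule indep_vars_compose2[OF indep]) simp
  then have "indep_vars (\<lambda>_. borel) (\<lambda>k \<omega>. X k \<omega> - \<mu>) (insert i {j})"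
    by (rule indep_vars_subset) (use assms(2,3) in simp)
  then have "indep_var borel (\<lambda>\<omega>. X i \<omega> - \<mu>) borel (\<lambda>\<omega>. X j \<omega> - \<mu>)"
    \<comment> \<open>\<open>indep_vars_sum\<close> separates one variable from a sum of others;
      over the singleton \<open>{j}\<close> that sum is a single variable.\<close>
    using indep_vars_sum[of "{j}" i] False by simp
  moreover have "integrable M (\<lambda>\<omega>. X k \<omega> - \<mu>)" "expectation (\<lambda>\<omega>. X k \<omega> - \<mu>) = 0" if "k \<in> I" for k
    using int[OF that] mean[OF that] by (simp_all add: prob_space)
  ultimately show ?thesis
    using False assms(2,3)
    by (simp add: has_bochner_integral_iff indep_var_integrable indep_var_lebesgue_integral)
qed

theorem mainTheorem1:
  fixes M :: "'a measure" and X :: "nat \<Rightarrow> 'a \<Rightarrow> real" and c :: "nat \<Rightarrow> real"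
    and N :: nat and \<mu> \<sigma> :: real
  assumes "prob_space M"
    and "N \<ge> 2"
    and "iid M X {1..N}"
    and "\<And>n. n \<in> {1..N} \<Longrightarrow> integrable M (X n)"
    and "\<And>n. n \<in> {1..N} \<Longrightarrow> prob_space.expectation M (X n) = \<mu>"
    and "\<And>n. n \<in> {1..N} \<Longrightarrow> integrable M (\<lambda>\<omega>. (X n \<omega> - \<mu>)\<^sup>2)"
    and "\<And>n. n \<in> {1..N} \<Longrightarrow> prob_space.variance M (X n) = \<sigma>\<^sup>2"
    and "(\<Sum>n=1..N. c n) = 1"
    and "(\<Sum>n=1..N. (c n)\<^sup>2) = 2 / real N"
  shows "unbiased_estimator M (weighted_sample_var N c X) (\<sigma>\<^sup>2) \<and>
         unbiased_estimator M (weighted_mean N c X) \<mu>"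
proof
  interpret prob_space M by fact
  define Y where "Y n \<omega> = X n \<omega> - \<mu>" for n \<omega>
  define L where "L \<omega> = (\<Sum>n=1..N. c n * Y n \<omega>)" for \<omega>
  have N: "real N > 0" using \<open>N \<ge> 2\<close> by simp
  have indep: "indep_vars (\<lambda>_. borel) X {1..N}"
    using \<open>iid M X {1..N}\<close> by (simp add: iid_def)
  have orth: "has_bochner_integral M (\<lambda>\<omega>. Y i \<omega> * Y j \<omega>) (if i = j then \<sigma>\<^sup>2 else 0)"
    if "i \<in> {1..N}" "j \<in> {1..N}" for i j
    unfolding Y_def by (rule has_bochner_integral_indep_centred[OF indep that assms(4-7)])
  note comb = has_bochner_integral_orthogonal_linear_combinations
    [where I = "{1..N}" and Y = Y, OF finite_atLeastAtMost orth]
  have sq: "has_bochner_integral M (\<lambda>\<omega>. \<Sum>n=1..N. Y n \<omega> * Y n \<omega>) (\<Sum>n=1..N. \<sigma>\<^sup>2)"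
    using orth by (intro has_bochner_integral_sum) fastforce
  \<comment> \<open>The plain sum of the \<open>Y n\<close> has all coefficients 1, so the factor in
    front of the variance is \<open>\<Sum>n. c n * 1\<close>, which is 1.\<close>
  have cross: "has_bochner_integral M (\<lambda>\<omega>. L \<omega> * (\<Sum>n=1..N. Y n \<omega>)) (\<sigma>\<^sup>2)"
    using comb[where a = c and b = "\<lambda>_. 1"] assms(8) by (simp add: L_def)
  have LL: "has_bochner_integral M (\<lambda>\<omega>. L \<omega> * L \<omega>) (2 / real N * \<sigma>\<^sup>2)"
    using comb[where a = c and b = c] assms(9) by (simp add: L_def power2_eq_square)
  have dev: "X n \<omega> - weighted_mean N c X \<omega> = Y n \<omega> - L \<omega>" for n \<omega>
    using assms(8)
    by (simp add: weighted_mean_def L_def Y_def right_diff_distrib sum_subtractf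
        flip: sum_distrib_right)
  have "weighted_sample_var N c X \<omega> = 1 / real N *
      ((\<Sum>n=1..N. Y n \<omega> * Y n \<omega>) - 2 * (L \<omega> * (\<Sum>n=1..N. Y n \<omega>)) + real N * (L \<omega> * L \<omega>))" for \<omega>
  proof -
    have "(\<Sum>n=1..N. (Y n \<omega> - L \<omega>)\<^sup>2)
        = (\<Sum>n=1..N. Y n \<omega> * Y n \<omega> - 2 * (L \<omega> * Y n \<omega>) + L \<omega> * L \<omega>)"
      by (intro sum.cong) (auto simp: power2_eq_square algebra_simps)
    then show ?thesis
      by (simp add: weighted_sample_var_def dev sum.distrib sum_subtractf sum_distrib_left)
  qed
  moreover have "has_bochner_integral M (\<lambda>\<omega>. 1 / real N *
      ((\<Sum>n=1..N. Y n \<omega> * Y n \<omega>) - 2 * (L \<omega> * (\<Sum>n=1..N. Y n \<omega>)) + real N * (L \<omega> * L \<omega>)))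
      (1 / real N * ((\<Sum>n=1..N. \<sigma>\<^sup>2) - 2 * \<sigma>\<^sup>2 + real N * (2 / real N * \<sigma>\<^sup>2)))"
    by (intro has_bochner_integral_mult_right has_bochner_integral_add has_bochner_integral_diff
        sq cross LL)
  \<comment> \<open>Both divisions by \<open>real N\<close> cancel only because it is nonzero: in
    HOL the left side would be 0 for \<open>N = 0\<close>.\<close>
  moreover have "1 / real N * ((\<Sum>n=1..N. \<sigma>\<^sup>2) - 2 * \<sigma>\<^sup>2 + real N * (2 / real N * \<sigma>\<^sup>2)) = \<sigma>\<^sup>2"
    using N by simp
  ultimately have "has_bochner_integral M (weighted_sample_var N c X) (\<sigma>\<^sup>2)"
    by (simp add: fun_eq_iff cong: has_bochner_integral_cong)
  then show "unbiased_estimator M (weighted_sample_var N c X) (\<sigma>\<^sup>2)"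
    by (simp add: unbiased_estimator_def has_bochner_integral_iff)
  \<comment> \<open>Linearity; factoring out \<mu> below leaves the sum of the weights, which is
    1.\<close>
  have "has_bochner_integral M (\<lambda>\<omega>. \<Sum>n=1..N. c n * X n \<omega>) (\<Sum>n=1..N. c n * \<mu>)"
    using assms(4,5)
    by (intro has_bochner_integral_sum has_bochner_integral_mult_right)
      (simp add: has_bochner_integral_iff)
  then show "unbiased_estimator M (weighted_mean N c X) \<mu>"
    using assms(8)
    by (simp add: unbiased_estimator_def has_bochner_integral_iff weighted_mean_def[abs_def]
        flip: sum_distrib_right)
qed

end
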